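(* Let $q$ be a prime power, let $N,D$ be integers with $D\ge3$, $N\ge2D$, let $C$ be a Delsarte clique of the Grassmann graph $J_q(N,D)$ and $x\in C$. Let $\mathbf W=\mathrm{span}\{\hat C^\pm_i\}_{i=0}^{D-1}$, regarded as a module for the confluent Cherednik algebra $\mathcal H_{\mathrm V}=\mathcal H_{\mathrm V}(k,k',u;q)$ with $k=\sqrt{-1}q^{(D-N-1)/2}$, $k'=\sqrt{-1}q^{-D/2}$, $u=q^{D-N/2}$. Then: (i) The $\mathcal H_{\mathrm V}$-module $\mathbf W$ is irreducible. (ii) On $\mathbf W$ the elements $\mathcal T$ and $\mathcal T'$ are both diagonalizable; moreover $(\mathcal T+k^{-1})/(k+k^{-1})$ (resp. $(\mathcal T'+k'^{-1})/(k'+k'^{-1})$) acts as the projection from $\mathbf W$ onto the eigenspace of $\mathcal T$ (resp. $\mathcal T'$) corresponding to $k$ (resp. $k'$).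
   Context: Graph notation. $\Gamma=J_q(N,D)$ has as vertex set $X$ all $D$-dimensional subspaces of an $N$-dimensional vector space over $\mathbb F_q$, adjacency meaning intersection of dimension $D-1$; $\partial$ is path-length distance. A Delsarte clique is a clique of size $\frac{q^{N-D+1}-1}{q-1}$ (attaining the Hoffman bound). For $0\le i\le D-1$: $C_i=\{y\in X:\min_{z\in C}\partial(y,z)=i\}$, $C^-_i=\{y\in C_i:\partial(x,y)=i\}$, $C^+_i=\{y\in C_i:\partial(x,y)=i+1\}$ (all nonempty, partitioning $X$). $\hat Y\in\mathbb C^X$ is the characteristic vector of $Y\subseteq X$. Algebra. $q^{1/2}>0$. $\mathcal H_{\mathrm V}(k,k',u;q)$ is the associative unital $\mathbb C$-algebra with generators $\mathcal T,\mathcal T',\mathcal U,\mathcal U'$ and relations $(\mathcal T-k)(\mathcal T+k^{-1})=0$, $\mathcal U'(\mathcal U'+1)=0$, $(\mathcal T'-k')(\mathcal T'+k'^{-1})=0$, $\mathcal U(\mathcal U+u^{-1})=0$, $q^{1/2}\mathcal T'\mathcal T\mathcal U'=\mathcal U+u^{-1}$, $q^{1/2}\mathcal U\mathcal T'\mathcal T=\mathcal U'+1$. Module structure. With respect to the ordered basis $\hat C^-_0,\hat C^+_0,\hat C^-_1,\hat C^+_1,\dots,\hat C^-_{D-1},\hat C^+_{D-1}$ of $\mathbf W$ (columns = images of basis vectors), $\mathcal T,\mathcal U',\mathcal T',\mathcal U$ act as $\mathrm{blockdiag}[t(0),\dots,t(D-1)]$, $\mathrm{blockdiag}[u'(0),\dots,u'(D-1)]$,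 $\mathrm{blockdiag}[t'(0),\dots,t'(D)]$, $\mathrm{blockdiag}[u(0),\dots,u(D)]$ respectively, where for $0\le i\le D-1$ $$t(i)=k\begin{bmatrix}1-q^{i+1}+q^{N-D+1}& q^{N-D+1}(q^{D-N+i}-1)\\ 1-q^{i+1}&q^{i+1}\end{bmatrix},\qquad u'(i)=\begin{bmatrix}-1&0\\ q^{-i-1}-1&0\end{bmatrix},$$ for $1\le i\le D-1$ $$t'(i)=k'\begin{bmatrix}1-q^i+q^D&q^i-q^D\\1-q^i&q^i\end{bmatrix},\qquad u(i)=u^{-1}\begin{bmatrix}-1&1-q^{D-i}\\0&0\end{bmatrix},$$ and $t'(0)=t'(D)=[k']$, $u(0)=[0]$, $u(D)=[-u^{-1}]$ are $1\times1$. *)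

theory Defs
  imports
    Complex_Main
    "HOL-Library.Function_Algebras"
    "HOL-Library.Indicator_Function"
    "HOL-Library.Poly_Mapping"
    "HOL-Number_Theory.Prime_Powers"
    "HOL-Algebra.QuotRing"
    "Jordan_Normal_Form.Matrix"
begin

section \<open>The Grassmann graph\<close>

text \<open>The ambient vector space over the finite field is the whole type \<open>'v\<close>, with scalar
  multiplication \<open>scl\<close>.\<close>

definition grassmann_verts ::
  "('f::field \<Rightarrow> 'v::ab_group_add \<Rightarrow> 'v) \<Rightarrow> nat \<Rightarrow> 'v set set" where
  "grassmann_verts scl D = {S. module.subspace scl S \<and> vector_space.dim scl S = D}"

definition grassmann_adj ::
  "('f::field \<Rightarrow> 'v::ab_group_add \<Rightarrow> 'v) \<Rightarrow> nat \<Rightarrow> ('v set \<times> 'v set) set" where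
  "grassmann_adj scl D =
     {(S, T). S \<in> grassmann_verts scl D \<and> T \<in> grassmann_verts scl D
        \<and> vector_space.dim scl (S \<inter> T) = D - 1}"

text \<open>\<open>(y, z) \<in> E ^^ n\<close> says that there is a walk of length \<open>n\<close> from \<open>y\<close> to \<open>z\<close>.\<close>

definition path_dist :: "('a \<times> 'a) set \<Rightarrow> 'a \<Rightarrow> 'a \<Rightarrow> nat" where
  "path_dist E y z = (LEAST n. (y, z) \<in> E ^^ n)"

definition delsarte_clique ::
  "('f::field \<Rightarrow> 'v::ab_group_add \<Rightarrow> 'v) \<Rightarrow> nat \<Rightarrow> nat \<Rightarrow> nat \<Rightarrow> 'v set set \<Rightarrow> bool" where
  "delsarte_clique scl q N D C \<longleftrightarrow>
     C \<subseteq> grassmann_verts scl D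
     \<and> (\<forall>y\<in>C. \<forall>z\<in>C. y \<noteq> z \<longrightarrow> (y, z) \<in> grassmann_adj scl D)
     \<and> real (card C) = (real q ^ (N - D + 1) - 1) / (real q - 1)"

definition clique_cell ::
  "('f::field \<Rightarrow> 'v::ab_group_add \<Rightarrow> 'v) \<Rightarrow> nat \<Rightarrow> 'v set set \<Rightarrow> nat \<Rightarrow> 'v set set" where
  "clique_cell scl D C i =
     {y \<in> grassmann_verts scl D. Min ((\<lambda>z. path_dist (grassmann_adj scl D) y z) ` C) = i}"

definition clique_cell_minus ::
  "('f::field \<Rightarrow> 'v::ab_group_add \<Rightarrow> 'v) \<Rightarrow> nat \<Rightarrow> 'v set set \<Rightarrow> 'v set \<Rightarrow> nat \<Rightarrow> 'v set set" where
  "clique_cell_minus scl D C x i =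
     {y \<in> clique_cell scl D C i. path_dist (grassmann_adj scl D) x y = i}"

definition clique_cell_plus ::
  "('f::field \<Rightarrow> 'v::ab_group_add \<Rightarrow> 'v) \<Rightarrow> nat \<Rightarrow> 'v set set \<Rightarrow> 'v set \<Rightarrow> nat \<Rightarrow> 'v set set" where
  "clique_cell_plus scl D C x i =
     {y \<in> clique_cell scl D C i. path_dist (grassmann_adj scl D) x y = i + 1}"


section \<open>The space of complex-valued functions\<close>

text \<open>Vectors indexed by a set \<open>X\<close> of elements of type \<open>'x\<close> are represented as functions
  \<open>'x \<Rightarrow> complex\<close> vanishing outside \<open>X\<close>; addition of functions is pointwise.  The
  characteristic vector of \<open>Y \<subseteq> X\<close> is \<open>indicator Y\<close>.\<close>

definition cscale :: "complex \<Rightarrow> ('x \<Rightarrow> complex) \<Rightarrow> 'x \<Rightarrow> complex" where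
  "cscale c f = (\<lambda>y. c * f y)"

interpretation CX: vector_space "cscale :: complex \<Rightarrow> ('x \<Rightarrow> complex) \<Rightarrow> 'x \<Rightarrow> complex"
  by standard (auto simp: cscale_def fun_eq_iff algebra_simps)

text \<open>The ordered list \<open>C\<^sub>0\<^sup>-, C\<^sub>0\<^sup>+, C\<^sub>1\<^sup>-, C\<^sub>1\<^sup>+, \<dots>\<close> of characteristic vectors, indexed from 0.\<close>

definition cell_vec ::
  "('f::field \<Rightarrow> 'v::ab_group_add \<Rightarrow> 'v) \<Rightarrow> nat \<Rightarrow> 'v set set \<Rightarrow> 'v set \<Rightarrow> nat \<Rightarrow> 'v set \<Rightarrow> complex" where
  "cell_vec scl D C x j =
     indicator (if even j then clique_cell_minus scl D C x (j div 2)
                else clique_cell_plus scl D C x (j div 2))"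

definition cell_space ::
  "('f::field \<Rightarrow> 'v::ab_group_add \<Rightarrow> 'v) \<Rightarrow> nat \<Rightarrow> 'v set set \<Rightarrow> 'v set \<Rightarrow> ('v set \<Rightarrow> complex) set" where
  "cell_space scl D C x =
     CX.span (\<Union>i<D. {indicator (clique_cell_minus scl D C x i),
                       indicator (clique_cell_plus scl D C x i)})"


section \<open>The confluent Cherednik algebra\<close>

datatype hv_gen = Gen_T | Gen_U' | Gen_T' | Gen_U

text \<open>The free monoid on the generators, written additively because \<open>poly_mapping\<close> forms
  monoid algebras over additive monoids.\<close>

datatype hv_word = Word "hv_gen list"

instantiation hv_word :: monoid_add
begin

definition zero_hv_word :: hv_word where
  "0 = Word []"

fun plus_hv_word :: "hv_word \<Rightarrow> hv_word \<Rightarrow> hv_word" where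
  "Word v + Word w = Word (v @ w)"

instance
proof
  fix a b c :: hv_word
  show "a + b + c = a + (b + c)" by (cases a; cases b; cases c) simp
  show "0 + a = a" by (cases a) (simp add: zero_hv_word_def)
  show "a + 0 = a" by (cases a) (simp add: zero_hv_word_def)
qed

end

type_synonym hv_free = "hv_word \<Rightarrow>\<^sub>0 complex"

definition hv_const :: "complex \<Rightarrow> hv_free" where
  "hv_const c = Poly_Mapping.single 0 c"

definition hv_var :: "hv_gen \<Rightarrow> hv_free" where
  "hv_var g = Poly_Mapping.single (Word [g]) 1"

definition hv_free_ring :: "hv_free ring" where
  "hv_free_ring = \<lparr>carrier = UNIV, mult = (*), one = 1, zero = 0, add = (+)\<rparr>"

lemma ring_hv_free_ring: "ring hv_free_ring"
proof (rule ringI)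
  show "abelian_group hv_free_ring"
  proof (rule abelian_groupI)
    fix a assume "a \<in> carrier hv_free_ring"
    show "\<exists>b\<in>carrier hv_free_ring. b \<oplus>\<^bsub>hv_free_ring\<^esub> a = \<zero>\<^bsub>hv_free_ring\<^esub>"
      by (rule bexI[of _ "- a"]) (simp_all add: hv_free_ring_def)
  qed (simp_all add: hv_free_ring_def algebra_simps)
  show "monoid hv_free_ring"
    by (rule monoidI) (simp_all add: hv_free_ring_def algebra_simps)
qed (simp_all add: hv_free_ring_def algebra_simps)

definition hv_relators :: "complex \<Rightarrow> complex \<Rightarrow> complex \<Rightarrow> real \<Rightarrow> hv_free set" where
  "hv_relators k k' u q =
     (let T = hv_var Gen_T; U' = hv_var Gen_U'; T' = hv_var Gen_T'; U = hv_var Gen_U;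
          s = hv_const (complex_of_real (sqrt q))
      in {(T - hv_const k) * (T + hv_const (inverse k)),
          U' * (U' + 1),
          (T' - hv_const k') * (T' + hv_const (inverse k')),
          U * (U + hv_const (inverse u)),
          s * T' * T * U' - (U + hv_const (inverse u)),
          s * U * T' * T - (U' + 1)})"

definition hv_ideal :: "complex \<Rightarrow> complex \<Rightarrow> complex \<Rightarrow> real \<Rightarrow> hv_free set" where
  "hv_ideal k k' u q = genideal hv_free_ring (hv_relators k k' u q)"

definition HV :: "complex \<Rightarrow> complex \<Rightarrow> complex \<Rightarrow> real \<Rightarrow> hv_free set ring" where
  "HV k k' u q = hv_free_ring Quot hv_ideal k k' u q"

definition hv_class :: "complex \<Rightarrow> complex \<Rightarrow> complex \<Rightarrow> real \<Rightarrow> hv_free \<Rightarrow> hv_free set" where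
  "hv_class k k' u q a = hv_ideal k k' u q +>\<^bsub>hv_free_ring\<^esub> a"

text \<open>Left modules.  The axiom \<open>act_const\<close> makes the action one of complex algebras.\<close>

locale hv_module =
  fixes k k' u :: complex and q :: real
    and W :: "('x \<Rightarrow> complex) set"
    and act :: "hv_free set \<Rightarrow> ('x \<Rightarrow> complex) \<Rightarrow> ('x \<Rightarrow> complex)"
  assumes subspace: "CX.subspace W"
    and act_closed: "\<lbrakk>a \<in> carrier (HV k k' u q); w \<in> W\<rbrakk> \<Longrightarrow> act a w \<in> W"
    and act_add_right: "\<lbrakk>a \<in> carrier (HV k k' u q); v \<in> W; w \<in> W\<rbrakk>
          \<Longrightarrow> act a (v + w) = act a v + act a w"
    and act_add_left: "\<lbrakk>a \<in> carrier (HV k k' u q); b \<in> carrier (HV k k' u q); w \<in> W\<rbrakk>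
          \<Longrightarrow> act (a \<oplus>\<^bsub>HV k k' u q\<^esub> b) w = act a w + act b w"
    and act_mult: "\<lbrakk>a \<in> carrier (HV k k' u q); b \<in> carrier (HV k k' u q); w \<in> W\<rbrakk>
          \<Longrightarrow> act (a \<otimes>\<^bsub>HV k k' u q\<^esub> b) w = act a (act b w)"
    and act_one: "w \<in> W \<Longrightarrow> act \<one>\<^bsub>HV k k' u q\<^esub> w = w"
    and act_const: "w \<in> W \<Longrightarrow> act (hv_class k k' u q (hv_const c)) w = cscale c w"

definition hv_submodule ::
  "complex \<Rightarrow> complex \<Rightarrow> complex \<Rightarrow> real \<Rightarrow> ('x \<Rightarrow> complex) set
    \<Rightarrow> (hv_free set \<Rightarrow> ('x \<Rightarrow> complex) \<Rightarrow> ('x \<Rightarrow> complex)) \<Rightarrow> ('x \<Rightarrow> complex) set \<Rightarrow> bool" where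
  "hv_submodule k k' u q W act S \<longleftrightarrow>
     CX.subspace S \<and> S \<subseteq> W \<and> (\<forall>a\<in>carrier (HV k k' u q). \<forall>w\<in>S. act a w \<in> S)"

definition hv_irreducible ::
  "complex \<Rightarrow> complex \<Rightarrow> complex \<Rightarrow> real \<Rightarrow> ('x \<Rightarrow> complex) set
    \<Rightarrow> (hv_free set \<Rightarrow> ('x \<Rightarrow> complex) \<Rightarrow> ('x \<Rightarrow> complex)) \<Rightarrow> bool" where
  "hv_irreducible k k' u q W act \<longleftrightarrow>
     hv_module k k' u q W act \<and> W \<noteq> {0}
     \<and> (\<forall>S. hv_submodule k k' u q W act S \<longrightarrow> S = {0} \<or> S = W)"


section \<open>Linear algebra on a subspace\<close>

text \<open>\<open>f\<close> has matrix \<open>M\<close> with respect to \<open>b 0, b 1, \<dots>\<close>: columns are images of basis vectors.\<close>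

definition acts_by_matrix ::
  "(nat \<Rightarrow> 'x \<Rightarrow> complex) \<Rightarrow> complex mat \<Rightarrow> (('x \<Rightarrow> complex) \<Rightarrow> ('x \<Rightarrow> complex)) \<Rightarrow> bool" where
  "acts_by_matrix b M f \<longleftrightarrow>
     (\<forall>j<dim_col M. f (b j) = (\<Sum>i<dim_row M. cscale (M $$ (i, j)) (b i)))"

definition eigenspace ::
  "('x \<Rightarrow> complex) set \<Rightarrow> (('x \<Rightarrow> complex) \<Rightarrow> ('x \<Rightarrow> complex)) \<Rightarrow> complex \<Rightarrow> ('x \<Rightarrow> complex) set" where
  "eigenspace W f c = {w \<in> W. f w = cscale c w}"

definition diagonalizable_on ::
  "('x \<Rightarrow> complex) set \<Rightarrow> (('x \<Rightarrow> complex) \<Rightarrow> ('x \<Rightarrow> complex)) \<Rightarrow> bool" where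
  "diagonalizable_on W f \<longleftrightarrow>
     (\<exists>B. CX.independent B \<and> CX.span B = W \<and> (\<forall>b\<in>B. \<exists>c. f b = cscale c b))"

text \<open>\<open>P\<close> restricted to \<open>W\<close> is the projection onto the eigenspace of the diagonalizable map \<open>f\<close>
  for its eigenvalue \<open>c\<close>, along the other eigenspaces.\<close>

definition eigenprojection ::
  "('x \<Rightarrow> complex) set \<Rightarrow> (('x \<Rightarrow> complex) \<Rightarrow> ('x \<Rightarrow> complex)) \<Rightarrow> complex
    \<Rightarrow> (('x \<Rightarrow> complex) \<Rightarrow> ('x \<Rightarrow> complex)) \<Rightarrow> bool" where
  "eigenprojection W f c P \<longleftrightarrow>
     eigenspace W f c \<noteq> {0}
     \<and> (\<forall>v\<in>W. \<forall>w\<in>W. P (v + w) = P v + P w)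
     \<and> (\<forall>a. \<forall>w\<in>W. P (cscale a w) = cscale a (P w))
     \<and> P ` W = eigenspace W f c
     \<and> (\<forall>w\<in>eigenspace W f c. P w = w)
     \<and> (\<forall>d. d \<noteq> c \<longrightarrow> (\<forall>w\<in>eigenspace W f d. P w = 0))"


section \<open>The matrices of the generators\<close>

definition block_t :: "complex \<Rightarrow> nat \<Rightarrow> nat \<Rightarrow> nat \<Rightarrow> nat \<Rightarrow> complex mat" where
  "block_t k q N D i = (let p = complex_of_nat q in
     k \<cdot>\<^sub>m mat_of_rows_list 2
       [[1 - p ^ (i + 1) + p ^ (N - D + 1),
         p ^ (N - D + 1) * (p powi (int D - int N + int i) - 1)],
        [1 - p ^ (i + 1), p ^ (i + 1)]])"

definition block_u' :: "nat \<Rightarrow> nat \<Rightarrow> complex mat" where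
  "block_u' q i = (let p = complex_of_nat q in
     mat_of_rows_list 2 [[-1, 0], [p powi (- int i - 1) - 1, 0]])"

definition block_t' :: "complex \<Rightarrow> nat \<Rightarrow> nat \<Rightarrow> nat \<Rightarrow> complex mat" where
  "block_t' k' q D i = (let p = complex_of_nat q in
     if i = 0 \<or> i = D then mat_of_rows_list 1 [[k']]
     else k' \<cdot>\<^sub>m mat_of_rows_list 2 [[1 - p ^ i + p ^ D, p ^ i - p ^ D], [1 - p ^ i, p ^ i]])"

definition block_u :: "complex \<Rightarrow> nat \<Rightarrow> nat \<Rightarrow> nat \<Rightarrow> complex mat" where
  "block_u u q D i = (let p = complex_of_nat q in
     if i = 0 then mat_of_rows_list 1 [[0]]
     else if i = D then mat_of_rows_list 1 [[- inverse u]]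
     else inverse u \<cdot>\<^sub>m mat_of_rows_list 2 [[-1, 1 - p ^ (D - i)], [0, 0]])"

definition mat_T :: "complex \<Rightarrow> nat \<Rightarrow> nat \<Rightarrow> nat \<Rightarrow> complex mat" where
  "mat_T k q N D = diag_block_mat (map (block_t k q N D) [0..<D])"

definition mat_U' :: "nat \<Rightarrow> nat \<Rightarrow> complex mat" where
  "mat_U' q D = diag_block_mat (map (block_u' q) [0..<D])"

definition mat_T' :: "complex \<Rightarrow> nat \<Rightarrow> nat \<Rightarrow> complex mat" where
  "mat_T' k' q D = diag_block_mat (map (block_t' k' q D) [0..<D + 1])"

definition mat_U :: "complex \<Rightarrow> nat \<Rightarrow> nat \<Rightarrow> complex mat" where
  "mat_U u q D = diag_block_mat (map (block_u u q D) [0..<D + 1])"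

end

theory Submission
  imports Defs
begin

text \<open>In the cell basis \<open>\<T>\<U>'\<close> and \<open>\<U>\<T>'\<close> are diagonal: \<open>\<T>\<U>'\<close> has distinct nonzero eigenvalues on
  the \<open>C\<^sub>i\<^sup>-\<close> and vanishes on the \<open>C\<^sub>i\<^sup>+\<close>, and \<open>\<U>\<T>'\<close> behaves the other way round.  Hence a submodule
  containing a vector with nonzero coefficient at a basis vector contains that basis vector.
  Since the off-diagonal entries of \<open>\<T>\<close> link \<open>C\<^sub>i\<^sup>-\<close> with \<open>C\<^sub>i\<^sup>+\<close> and those of \<open>\<T>'\<close> link
  \<open>C\<^sub>i\<^sup>+\<close> with \<open>C\<^sub>i\<^sub>+\<^sub>1\<^sup>-\<close>, a nonzero submodule contains all basis vectors.  This works for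
  any spanning family, linearly independent or not, so the only fact about the graph that enters
  is \<open>x \<in> C\<^sub>0\<^sup>-\<close>, which gives \<open>W \<noteq> 0\<close>.  Part (ii) follows from the quadratic relations, as
  \<open>k \<noteq> - k\<inverse>\<close>.\<close>

section \<open>The action of the free algebra\<close>

lemma ideal_hv_ideal: "ideal (hv_ideal k k' u q) hv_free_ring"
  unfolding hv_ideal_def
  by (rule ring.genideal_ideal[OF ring_hv_free_ring]) (simp add: hv_free_ring_def)

lemma hv_class_carrier: "hv_class k k' u q a \<in> carrier (HV k k' u q)"
  by (auto simp: hv_class_def HV_def FactRing_def A_RCOSETS_def' hv_free_ring_def)

lemma hv_class_mult:
  "hv_class k k' u q a \<otimes>\<^bsub>HV k k' u q\<^esub> hv_class k k' u q b = hv_class k k' u q (a * b)"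
proof -
  have "hv_class k k' u q a \<otimes>\<^bsub>HV k k' u q\<^esub> hv_class k k' u q b
      = hv_class k k' u q (a \<otimes>\<^bsub>hv_free_ring\<^esub> b)"
    unfolding hv_class_def HV_def FactRing_def
    using ideal.rcoset_mult_add[OF ideal_hv_ideal, of a b k k' u q]
    by (simp add: hv_free_ring_def)
  then show ?thesis by (simp add: hv_free_ring_def)
qed

lemma hv_class_add:
  "hv_class k k' u q a \<oplus>\<^bsub>HV k k' u q\<^esub> hv_class k k' u q b = hv_class k k' u q (a + b)"
proof -
  interpret I: ideal "hv_ideal k k' u q" hv_free_ring by (rule ideal_hv_ideal)
  have "hv_class k k' u q a \<oplus>\<^bsub>HV k k' u q\<^esub> hv_class k k' u q b
      = hv_class k k' u q (a \<oplus>\<^bsub>hv_free_ring\<^esub> b)"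
    unfolding hv_class_def HV_def FactRing_def
    using I.a_rcos_sum[of a b] by (simp add: hv_free_ring_def)
  then show ?thesis by (simp add: hv_free_ring_def)
qed

lemma hv_class_relator:
  assumes "r \<in> hv_relators k k' u q"
  shows "hv_class k k' u q r = hv_class k k' u q 0"
proof -
  interpret I: ideal "hv_ideal k k' u q" hv_free_ring by (rule ideal_hv_ideal)
  have "hv_relators k k' u q \<subseteq> hv_ideal k k' u q"
    unfolding hv_ideal_def
    by (rule ring.genideal_self[OF ring_hv_free_ring]) (simp add: hv_free_ring_def)
  then have "r \<in> hv_ideal k k' u q" using assms by blast
  then have "hv_ideal k k' u q +>\<^bsub>hv_free_ring\<^esub> r = hv_ideal k k' u q"
    by (rule I.a_rcos_const)
  moreover have "hv_ideal k k' u q +>\<^bsub>hv_free_ring\<^esub> \<zero>\<^bsub>hv_free_ring\<^esub> = hv_ideal k k' u q"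
    by (rule I.a_rcos_const) simp
  ultimately show ?thesis by (simp add: hv_class_def hv_free_ring_def)
qed

lemma hv_const_0: "hv_const 0 = 0"
  by (simp add: hv_const_def)

text \<open>Constants are supported on the empty word, the neutral element of the free monoid, so
  they commute with every variable. This is how \<open>act_const\<close> yields complex homogeneity
  of the generators.\<close>

lemma hv_const_var_commute: "hv_const c * hv_var g = hv_var g * hv_const c"
  by (simp add: hv_const_def hv_var_def mult_single)

section \<open>The generators as linear operators on \<open>W\<close>\<close>

context hv_module
begin

text \<open>Pulls the action back to the free algebra, so that computations use \<open>+\<close> and
  \<open>*\<close> there instead of operations on cosets.\<close>

abbreviation rho :: "hv_free \<Rightarrow> ('x \<Rightarrow> complex) \<Rightarrow> ('x \<Rightarrow> complex)" where
  "rho a \<equiv> act (hv_class k k' u q a)"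

lemma rho_closed: "w \<in> W \<Longrightarrow> rho a w \<in> W"
  by (rule act_closed[OF hv_class_carrier])

lemma rho_add_right: "v \<in> W \<Longrightarrow> w \<in> W \<Longrightarrow> rho a (v + w) = rho a v + rho a w"
  by (rule act_add_right[OF hv_class_carrier])

lemma rho_add: "w \<in> W \<Longrightarrow> rho (a + b) w = rho a w + rho b w"
  by (metis act_add_left hv_class_carrier hv_class_add)

lemma rho_mult: "w \<in> W \<Longrightarrow> rho (a * b) w = rho a (rho b w)"
  by (metis act_mult hv_class_carrier hv_class_mult)

lemma rho_const: "w \<in> W \<Longrightarrow> rho (hv_const c) w = cscale c w"
  by (rule act_const)

lemma rho_relator: "r \<in> hv_relators k k' u q \<Longrightarrow> w \<in> W \<Longrightarrow> rho r w = 0"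
  using rho_const[of w 0] by (simp add: hv_class_relator hv_const_0 cscale_def fun_eq_iff)

lemma rho_var_cscale:
  assumes "w \<in> W"
  shows "rho (hv_var g) (cscale c w) = cscale c (rho (hv_var g) w)"
proof -
  have "rho (hv_var g) (cscale c w) = rho (hv_var g * hv_const c) w"
    using assms by (simp add: rho_mult rho_const)
  also have "\<dots> = cscale c (rho (hv_var g) w)"
    using assms by (simp add: hv_const_var_commute[symmetric] rho_mult rho_const rho_closed)
  finally show ?thesis .
qed

lemma rho_var_comb:
  assumes "v \<in> W" "w \<in> W"
  shows "rho (hv_var g) (cscale a v + cscale c w)
    = cscale a (rho (hv_var g) v) + cscale c (rho (hv_var g) w)"
  using assms by (simp add: rho_add_right rho_var_cscale CX.subspace_scale[OF subspace])

text \<open>The relation says that the image of \<open>g + inverse c\<close> is annihilated by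
  \<open>g - c\<close>, hence consists of eigenvectors for \<open>c\<close>.\<close>

lemma rho_quadratic:
  assumes rel: "(hv_var g - hv_const c) * (hv_var g + hv_const (inverse c)) \<in> hv_relators k k' u q"
    and "w \<in> W"
  shows "rho (hv_var g) (rho (hv_var g) w + cscale (inverse c) w)
    = cscale c (rho (hv_var g) w + cscale (inverse c) w)"
proof -
  define v where "v = rho (hv_var g) w + cscale (inverse c) w"
  have v: "v = rho (hv_var g + hv_const (inverse c)) w"
    using assms by (simp add: v_def rho_add rho_const)
  then have vW: "v \<in> W" using assms rho_closed by simp
  have minus: "hv_var g - hv_const c = hv_var g + hv_const (- c)"
    by (simp add: hv_const_def single_uminus)
  have "rho (hv_var g) v + cscale (- c) v
      = rho ((hv_var g - hv_const c) * (hv_var g + hv_const (inverse c))) w"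
    using vW \<open>w \<in> W\<close> unfolding minus
    by (simp only: rho_mult v[symmetric] rho_add rho_const)
  also have "\<dots> = 0" using assms by (rule rho_relator)
  finally show ?thesis
    unfolding v_def by (simp add: CX.scale_minus_left add_eq_0_iff)
qed

text \<open>Applying the product of all \<open>f - d m\<close> with \<open>m\<close> different from
  \<open>j\<close> kills every term except the one at \<open>j\<close>, as in Lagrange
  interpolation. The values \<open>d\<close> only have to separate \<open>j\<close> from the other
  indices; those may share a value, which allows a large kernel of \<open>f\<close>.\<close>

lemma isolated_eigenvector_in_subspace:
  fixes n :: nat
  assumes S: "CX.subspace S" "S \<subseteq> W" "\<And>w. w \<in> S \<Longrightarrow> f w \<in> S"
    and f: "\<And>v w. v \<in> W \<Longrightarrow> w \<in> W \<Longrightarrow> f (v + w) = f v + f w"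
      "\<And>c w. w \<in> W \<Longrightarrow> f (cscale c w) = cscale c (f w)"
    and b: "\<And>l. l < n \<Longrightarrow> b l \<in> W" "\<And>l. l < n \<Longrightarrow> f (b l) = cscale (d l) (b l)"
    and w: "(\<Sum>l<n. cscale (c l) (b l)) \<in> S"
    and j: "j < n" "c j \<noteq> 0" "\<And>l. l < n \<Longrightarrow> l \<noteq> j \<Longrightarrow> d l \<noteq> d j"
  shows "b j \<in> S"
proof -
  have f0: "f 0 = 0"
    using f(2)[of 0 0] CX.subspace_0[OF subspace] by simp
  \<comment> \<open>Additivity of \<open>f\<close> is known on \<open>W\<close> only, so the partial
    sums are kept inside \<open>W\<close> along the induction.\<close>
  have f_sum: "f (\<Sum>l<m. cscale (e l) (b l)) = (\<Sum>l<m. cscale (d l * e l) (b l))"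
    if "m \<le> n" for m e
    using that
  proof (induction m)
    case 0
    then show ?case by (simp only: lessThan_0 sum.empty f0)
  next
    case (Suc m)
    have "(\<Sum>l<m. cscale (e l) (b l)) \<in> W" "cscale (e m) (b m) \<in> W"
      using Suc.prems b(1)
      by (auto intro!: CX.subspace_sum[OF subspace] CX.subspace_scale[OF subspace])
    then have "f ((\<Sum>l<m. cscale (e l) (b l)) + cscale (e m) (b m))
        = f (\<Sum>l<m. cscale (e l) (b l)) + f (cscale (e m) (b m))"
      by (rule f(1))
    also have "f (\<Sum>l<m. cscale (e l) (b l)) = (\<Sum>l<m. cscale (d l * e l) (b l))"
      using Suc by simp
    also have "f (cscale (e m) (b m)) = cscale (d m * e m) (b m)"
      using Suc.prems b f(2)[of "b m" "e m"] by (simp add: mult.commute)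
    finally show ?case by (simp only: sum.lessThan_Suc)
  qed
  \<comment> \<open>The factors are applied one at a time: \<open>f - d a\<close> multiplies the
    coefficient at \<open>l\<close> by \<open>d l - d a\<close> and stays within
    \<open>S\<close>.\<close>
  have "finite M \<Longrightarrow> (\<Sum>l<n. cscale (c l * (\<Prod>m\<in>M. d l - d m)) (b l)) \<in> S" for M
  proof (induction M rule: finite_induct)
    case empty
    then show ?case using w by simp
  next
    case (insert a M)
    let ?e = "\<lambda>l. c l * (\<Prod>m\<in>M. d l - d m)"
    have "f (\<Sum>l<n. cscale (?e l) (b l)) - cscale (d a) (\<Sum>l<n. cscale (?e l) (b l)) \<in> S"
      using insert.IH S by (intro CX.subspace_diff CX.subspace_scale) auto
    also have "f (\<Sum>l<n. cscale (?e l) (b l)) - cscale (d a) (\<Sum>l<n. cscale (?e l) (b l))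
        = (\<Sum>l<n. cscale (d l * ?e l - d a * ?e l) (b l))"
      by (simp add: f_sum CX.scale_sum_right CX.scale_left_diff_distrib sum_subtractf)
    also have "\<dots> = (\<Sum>l<n. cscale (c l * (\<Prod>m\<in>insert a M. d l - d m)) (b l))"
      using insert.hyps by (intro sum.cong) (auto simp: algebra_simps)
    finally show ?case .
  qed
  from this[of "{..<n} - {j}"]
  have "(\<Sum>l<n. cscale (c l * (\<Prod>m\<in>{..<n} - {j}. d l - d m)) (b l)) \<in> S" by simp
  also have "(\<Sum>l<n. cscale (c l * (\<Prod>m\<in>{..<n} - {j}. d l - d m)) (b l))
      = (\<Sum>l\<in>{j}. cscale (c l * (\<Prod>m\<in>{..<n} - {j}. d l - d m)) (b l))"
    using j(1) by (intro sum.mono_neutral_right) (auto simp: prod_zero_iff)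
  finally have "cscale (c j * (\<Prod>m\<in>{..<n} - {j}. d j - d m)) (b j) \<in> S" by simp
  moreover have "c j * (\<Prod>m\<in>{..<n} - {j}. d j - d m) \<noteq> 0"
    using j by (fastforce simp: prod_zero_iff)
  ultimately show ?thesis
    using CX.subspace_scale[OF S(1), of _ "inverse (c j * (\<Prod>m\<in>{..<n} - {j}. d j - d m))"]
    by (metis CX.scale_scale CX.scale_one left_inverse)
qed

end

text \<open>The decomposition \<open>w = P w + (w - P w)\<close> splits \<open>W\<close> into the
  eigenspaces for \<open>c\<close> and \<open>d\<close>. The vector \<open>v0\<close> ensures that
  \<open>c\<close> really is an eigenvalue.\<close>

lemma eigenprojection_of_quadratic:
  assumes W: "CX.subspace W" "\<And>w. w \<in> W \<Longrightarrow> f w \<in> W"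
    and f: "\<And>v w. v \<in> W \<Longrightarrow> w \<in> W \<Longrightarrow> f (v + w) = f v + f w"
      "\<And>c w. w \<in> W \<Longrightarrow> f (cscale c w) = cscale c (f w)"
    and quad: "\<And>w. w \<in> W \<Longrightarrow> f (f w - cscale d w) = cscale c (f w - cscale d w)"
    and cd: "c \<noteq> d"
    and nontrivial: "v0 \<in> W" "v0 \<noteq> 0" "f v0 = cscale c v0"
    and P: "\<And>w. w \<in> W \<Longrightarrow> P w = cscale (1 / (c - d)) (f w - cscale d w)"
  shows "diagonalizable_on W f \<and> eigenprojection W f c P"
proof
  note sub = CX.subspace_scale[OF W(1)] CX.subspace_diff[OF W(1)] CX.subspace_add[OF W(1)]
  have P_in: "P w \<in> eigenspace W f c" if "w \<in> W" for w
    using that W f quad sub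
    by (simp add: eigenspace_def P CX.scale_left_commute)
  have f_diff: "f (v - w) = f v - f w" if "v \<in> W" "w \<in> W" for v w
    using f(1)[of "v - w" w] that sub by simp
  have P_compl: "w - P w \<in> eigenspace W f d" if "w \<in> W" for w
  proof -
    have *: "f (P w) = cscale c (P w)" "P w \<in> W"
      using P_in[OF that] by (auto simp: eigenspace_def)
    have "cscale (c - d) (P w) = f w - cscale d w"
      using cd that by (simp add: P)
    then have "f w - cscale c (P w) = cscale d (w - P w)"
      by (simp add: CX.scale_left_diff_distrib CX.scale_right_diff_distrib algebra_simps)
    then show ?thesis using * that sub by (simp add: eigenspace_def f_diff)
  qed
  show "diagonalizable_on W f"
  proof -
    \<comment> \<open>A maximal independent subset of the union of the two eigenspaces consists of
      eigenvectors and spans both.\<close>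
    obtain B where B: "B \<subseteq> eigenspace W f c \<union> eigenspace W f d" "CX.independent B"
      "eigenspace W f c \<union> eigenspace W f d \<subseteq> CX.span B"
      by (rule CX.maximal_independent_subset)
    have "CX.span B \<subseteq> W"
      using B(1) W(1) by (intro CX.span_minimal) (auto simp: eigenspace_def)
    moreover have "w \<in> CX.span B" if "w \<in> W" for w
    proof -
      have "P w + (w - P w) \<in> CX.span B"
        using B(3) P_in[OF that] P_compl[OF that] by (intro CX.span_add) auto
      then show ?thesis by simp
    qed
    moreover have "\<exists>c. f b = cscale c b" if "b \<in> B" for b
      using B(1) that by (auto simp: eigenspace_def)
    ultimately show ?thesis
      unfolding diagonalizable_on_def using B(2) by blast
  qed
  have P_fix: "P w = w" if "w \<in> eigenspace W f c" for w
    using that cd by (simp add: eigenspace_def P CX.scale_left_diff_distrib[symmetric])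
  have P_kill: "P w = 0" if "w \<in> eigenspace W f e" "e \<noteq> c" for w e
  proof -
    have w: "w \<in> W" "f w = cscale e w" using that by (auto simp: eigenspace_def)
    then have Pw: "P w = cscale ((e - d) / (c - d)) w"
      by (simp add: P CX.scale_left_diff_distrib[symmetric])
    \<comment> \<open>\<open>P w\<close> is a multiple of \<open>w\<close>, hence scaled by
      \<open>e\<close>, and it also lies in the eigenspace for \<open>c\<close>; as \<open>e\<close>
      differs from \<open>c\<close>, it vanishes.\<close>
    have "f (P w) = cscale e (P w)" "f (P w) = cscale c (P w)"
      using P_in[OF w(1)] w by (auto simp: eigenspace_def Pw f(2) CX.scale_left_commute)
    then show ?thesis using that(2) CX.scale_right_imp_eq by metis
  qed
  have "v0 \<in> eigenspace W f c" using nontrivial by (simp add: eigenspace_def)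
  moreover have "P ` W = eigenspace W f c"
    using P_in P_fix by (force simp: eigenspace_def image_iff)
  moreover have "P (v + w) = P v + P w" if "v \<in> W" "w \<in> W" for v w
    using that sub
    by (simp add: P f CX.scale_right_diff_distrib CX.scale_right_distrib algebra_simps)
  moreover have "P (cscale a w) = cscale a (P w)" if "w \<in> W" for a w
    using that sub
    by (simp add: P f CX.scale_right_diff_distrib mult.commute)
  ultimately show "eigenprojection W f c P"
    unfolding eigenprojection_def using nontrivial(2) P_fix P_kill by blast
qed

text \<open>The second root is \<open>d = - inverse c\<close>, so \<open>c - d\<close> is
  \<open>c + inverse c\<close>, and its being nonzero says that the two roots are distinct.\<close>

lemma (in hv_module) eigenprojection_of_relator:
  assumes rel: "(hv_var g - hv_const c) * (hv_var g + hv_const (inverse c)) \<in> hv_relators k k' u q"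
    and c: "c + inverse c \<noteq> 0"
    and v0: "v0 \<in> W" "v0 \<noteq> 0" "rho (hv_var g) v0 = cscale c v0"
  shows "diagonalizable_on W (rho (hv_var g)) \<and>
    eigenprojection W (rho (hv_var g)) c
      (rho (hv_const (1 / (c + inverse c)) * (hv_var g + hv_const (inverse c))))"
proof (rule eigenprojection_of_quadratic[where d = "- inverse c" and ?v0.0 = v0])
  show "rho (hv_var g) (rho (hv_var g) w - cscale (- inverse c) w)
      = cscale c (rho (hv_var g) w - cscale (- inverse c) w)" if "w \<in> W" for w
    using rho_quadratic[OF rel that] by (simp add: CX.scale_minus_left)
  show "rho (hv_const (1 / (c + inverse c)) * (hv_var g + hv_const (inverse c))) w
      = cscale (1 / (c - - inverse c)) (rho (hv_var g) w - cscale (- inverse c) w)"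
    if "w \<in> W" for w
    using that rho_closed CX.subspace_add[OF subspace] CX.subspace_scale[OF subspace]
    by (simp add: rho_mult rho_add rho_const CX.scale_minus_left)
  show "c \<noteq> - inverse c" using c by (metis add.commute add.right_inverse)
qed (use subspace rho_closed rho_add_right rho_var_cscale v0 in auto)


section \<open>Block diagonal matrices\<close>

lemma sum_lessThan_add:
  fixes g :: "nat \<Rightarrow> 'a::comm_monoid_add"
  shows "(\<Sum>i<a + c. g i) = (\<Sum>i<a. g i) + (\<Sum>i<c. g (a + i))"
  by (induction c) (simp_all add: add.assoc)

text \<open>Since \<open>A\<close> is square, \<open>B\<close> has the same row and column offset,
  so one shift of \<open>b\<close> serves for arguments and images alike.\<close>

lemma acts_by_matrix_four_block:
  assumes A: "dim_row A = dim_col A"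
    and M: "acts_by_matrix b
      (four_block_mat A (0\<^sub>m (dim_row A) (dim_col B)) (0\<^sub>m (dim_row B) (dim_col A)) B) f"
  shows "acts_by_matrix b A f" "acts_by_matrix (\<lambda>j. b (dim_row A + j)) B f"
proof -
  show "acts_by_matrix b A f"
    unfolding acts_by_matrix_def
  proof (intro allI impI)
    fix j assume "j < dim_col A"
    with M A show "f (b j) = (\<Sum>i<dim_row A. cscale (A $$ (i, j)) (b i))"
      by (simp add: acts_by_matrix_def sum_lessThan_add)
  qed
  show "acts_by_matrix (\<lambda>j. b (dim_row A + j)) B f"
    unfolding acts_by_matrix_def
  proof (intro allI impI)
    fix j assume "j < dim_col B"
    moreover from this have "f (b (dim_col A + j)) = (\<Sum>i<dim_row A + dim_row B. cscale
        (four_block_mat A (0\<^sub>m (dim_row A) (dim_col B)) (0\<^sub>m (dim_row B) (dim_col A)) B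
          $$ (i, dim_col A + j)) (b i))"
      using M unfolding acts_by_matrix_def by simp
    ultimately show "f (b (dim_row A + j))
        = (\<Sum>i<dim_row B. cscale (B $$ (i, j)) (b (dim_row A + i)))"
      using A by (simp add: sum_lessThan_add)
  qed
qed

text \<open>The head block is split off repeatedly; each split shifts the basis, so \<open>b\<close>
  varies in the induction and the offsets add up.\<close>

lemma acts_by_matrix_diag_block:
  assumes "acts_by_matrix b (diag_block_mat As) f" "m < length As"
    and "\<And>A. A \<in> set As \<Longrightarrow> dim_row A = dim_col A"
  shows "acts_by_matrix (\<lambda>j. b (sum_list (map dim_row (take m As)) + j)) (As ! m) f"
  using assms
proof (induction As arbitrary: m b)
  case Nil
  then show ?case by simp
next
  case (Cons A As)
  have A: "dim_row A = dim_col A" using Cons.prems(3) by simp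
  note split = acts_by_matrix_four_block[OF A Cons.prems(1)[simplified Let_def diag_block_mat.simps]]
  show ?case
  proof (cases m)
    case 0
    then show ?thesis using split(1) by simp
  next
    case (Suc m')
    then show ?thesis
      using Cons.IH[OF split(2), of m'] Cons.prems by (simp add: add.assoc)
  qed
qed

lemma acts_by_matrix_1x1:
  assumes "acts_by_matrix b (mat_of_rows_list 1 [[a]]) f"
  shows "f (b 0) = cscale a (b 0)"
  using assms by (simp add: acts_by_matrix_def mat_of_rows_list_def)

lemma acts_by_matrix_2x2:
  assumes "acts_by_matrix b (s \<cdot>\<^sub>m mat_of_rows_list 2 [[a, c], [d, e]]) f"
  shows "f (b 0) = cscale (s * a) (b 0) + cscale (s * d) (b (Suc 0))"
    and "f (b (Suc 0)) = cscale (s * c) (b 0) + cscale (s * e) (b (Suc 0))"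
  using assms by (simp_all add: acts_by_matrix_def mat_of_rows_list_def numeral_2_eq_2)

lemma smult_mat_one: "(1::complex) \<cdot>\<^sub>m A = A"
  by (intro eq_matI) auto

lemma mat_T_block:
  assumes "acts_by_matrix b (mat_T k q N D) f" "i < D"
  shows "acts_by_matrix (\<lambda>j. b (2 * i + j)) (block_t k q N D i) f"
proof -
  have dim: "dim_row (block_t k q N D m) = 2" "dim_col (block_t k q N D m) = 2" for m
    by (simp_all add: block_t_def Let_def mat_of_rows_list_def)
  have "map dim_row (take i (map (block_t k q N D) [0..<D])) = replicate i 2"
    using assms(2) by (simp add: take_map o_def dim map_replicate_const)
  then show ?thesis
    using acts_by_matrix_diag_block[OF assms(1)[unfolded mat_T_def], of i] assms(2) dim
    by (fastforce simp: sum_list_replicate mult.commute)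
qed

lemma mat_U'_block:
  assumes "acts_by_matrix b (mat_U' q D) f" "i < D"
  shows "acts_by_matrix (\<lambda>j. b (2 * i + j)) (block_u' q i) f"
proof -
  have dim: "dim_row (block_u' q m) = 2" "dim_col (block_u' q m) = 2" for m
    by (simp_all add: block_u'_def Let_def mat_of_rows_list_def)
  have "map dim_row (take i (map (block_u' q) [0..<D])) = replicate i 2"
    using assms(2) by (simp add: take_map o_def dim map_replicate_const)
  then show ?thesis
    using acts_by_matrix_diag_block[OF assms(1)[unfolded mat_U'_def], of i] assms(2) dim
    by (fastforce simp: sum_list_replicate mult.commute)
qed

text \<open>The leading block of size 1 moves the later blocks to odd offsets, so they pair
  \<open>2 * i - 1\<close> with \<open>2 * i\<close>. For \<open>i = 0\<close>, truncated
  subtraction gives the correct offset 0.\<close>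

lemma sum_list_shifted_dims:
  fixes g :: "nat \<Rightarrow> nat"
  assumes "g 0 = 1" "\<And>m. 0 < m \<Longrightarrow> m < D \<Longrightarrow> g m = 2" "i \<le> D"
  shows "sum_list (map g [0..<i]) = 2 * i - 1"
  using assms(3)
proof (induction i)
  case (Suc i)
  then show ?case using assms(1,2) by (cases i) auto
qed simp

lemma mat_T'_block:
  assumes "acts_by_matrix b (mat_T' k' q D) f" "i \<le> D" "0 < D"
  shows "acts_by_matrix (\<lambda>j. b (2 * i - 1 + j)) (block_t' k' q D i) f"
proof -
  have dim: "dim_row (block_t' k' q D m) = (if m = 0 \<or> m = D then 1 else 2)"
    "dim_col (block_t' k' q D m) = (if m = 0 \<or> m = D then 1 else 2)" for m
    by (simp_all add: block_t'_def Let_def mat_of_rows_list_def)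
  have "sum_list (map dim_row (take i (map (block_t' k' q D) [0..<D + 1]))) = 2 * i - 1"
    using assms(2) sum_list_shifted_dims[of "\<lambda>m. dim_row (block_t' k' q D m)" D i]
    by (simp add: take_map o_def dim)
  moreover have "map (block_t' k' q D) [0..<D + 1] ! i = block_t' k' q D i"
    using assms(2) by (simp del: upt_Suc)
  ultimately show ?thesis
    using acts_by_matrix_diag_block[OF assms(1)[unfolded mat_T'_def], of i] assms(2) dim
    by fastforce
qed

lemma mat_U_block:
  assumes "acts_by_matrix b (mat_U u q D) f" "i \<le> D" "0 < D"
  shows "acts_by_matrix (\<lambda>j. b (2 * i - 1 + j)) (block_u u q D i) f"
proof -
  have dim: "dim_row (block_u u q D m) = (if m = 0 \<or> m = D then 1 else 2)"
    "dim_col (block_u u q D m) = (if m = 0 \<or> m = D then 1 else 2)" for m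
    by (simp_all add: block_u_def Let_def mat_of_rows_list_def)
  have "sum_list (map dim_row (take i (map (block_u u q D) [0..<D + 1]))) = 2 * i - 1"
    using assms(2) sum_list_shifted_dims[of "\<lambda>m. dim_row (block_u u q D m)" D i]
    by (simp add: take_map o_def dim)
  moreover have "map (block_u u q D) [0..<D + 1] ! i = block_u u q D i"
    using assms(2) by (simp del: upt_Suc)
  ultimately show ?thesis
    using acts_by_matrix_diag_block[OF assms(1)[unfolded mat_U_def], of i] assms(2) dim
    by fastforce
qed


section \<open>Irreducibility\<close>

text \<open>Coefficients are attached to indices rather than to vectors, so repetitions in
  \<open>b\<close> do no harm.\<close>

lemma span_lessThan_cases:
  assumes "w \<in> CX.span (b ` {..<n::nat})"
  obtains c where "w = (\<Sum>l<n. cscale (c l) (b l))"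
proof -
  have "\<exists>c. w = (\<Sum>l<n. cscale (c l) (b l))"
    using assms
  proof (induction rule: CX.span_induct_alt)
    case base
    have "0 = (\<Sum>l<n. cscale 0 (b l))" by simp
    then show ?case by (rule exI[of _ "\<lambda>_. 0"])
  next
    case (step a y z)
    then obtain j c where j: "j < n" "y = b j" and z: "z = (\<Sum>l<n. cscale (c l) (b l))"
      by auto
    have "(\<Sum>l<n. cscale (if l = j then a else 0) (b l))
        = (\<Sum>l<n. if l = j then cscale a (b l) else 0)"
      by (intro sum.cong) auto
    then have "(\<Sum>l<n. cscale ((if l = j then a else 0) + c l) (b l)) = cscale a y + z"
      using j by (simp add: z CX.scale_left_distrib sum.distrib)
    then show ?case
      by (intro exI[of _ "\<lambda>l. (if l = j then a else 0) + c l"]) simp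
  qed
  then show thesis using that by blast
qed

lemma comb_in_subspace_cancel:
  assumes "CX.subspace S" "v \<in> S" "cscale a v + cscale c w \<in> S" "c \<noteq> 0"
  shows "w \<in> S"
proof -
  have "(cscale a v + cscale c w) - cscale a v \<in> S"
    using assms by (intro CX.subspace_diff CX.subspace_scale)
  then have "cscale c w \<in> S" by simp
  with assms(1) have "cscale (inverse c) (cscale c w) \<in> S" by (rule CX.subspace_scale)
  then show ?thesis using assms(4) by simp
qed

text \<open>By \<open>isolated\<close>, a nonzero submodule contains some \<open>b j\<close>. In
  \<open>link\<close> both off-diagonal coefficients are nonzero, so membership travels up and down
  the chain.\<close>

lemma (in hv_module) irreducible_of_linked_basis:
  fixes n :: nat
  assumes W: "W = CX.span (b ` {..<n})" and b0: "0 < n" "b 0 \<noteq> 0"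
    and link: "\<And>j. Suc j < n \<Longrightarrow> \<exists>g a c a' c'. c \<noteq> 0 \<and> c' \<noteq> 0
      \<and> rho (hv_var g) (b j) = cscale a (b j) + cscale c (b (Suc j))
      \<and> rho (hv_var g) (b (Suc j)) = cscale c' (b j) + cscale a' (b (Suc j))"
    and isolated: "\<And>j. j < n \<Longrightarrow> \<exists>g h d.
      (\<forall>l<n. rho (hv_var g) (rho (hv_var h) (b l)) = cscale (d l) (b l))
      \<and> (\<forall>l<n. l \<noteq> j \<longrightarrow> d l \<noteq> d j)"
  shows "hv_irreducible k k' u q W act"
  unfolding hv_irreducible_def
proof (intro conjI allI impI)
  show "hv_module k k' u q W act" by (rule hv_module_axioms)
  have b: "b l \<in> W" if "l < n" for l
    using that by (auto simp: W intro: CX.span_base)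
  show "W \<noteq> {0}" using b[OF b0(1)] b0(2) by auto
  fix S assume "hv_submodule k k' u q W act S"
  then have S: "CX.subspace S" "S \<subseteq> W" and S_rho: "\<And>a w. w \<in> S \<Longrightarrow> rho a w \<in> S"
    by (auto simp: hv_submodule_def hv_class_carrier)
  show "S = {0} \<or> S = W"
  proof (cases "S = {0}")
    case False
    then obtain w where w: "w \<in> S" "w \<noteq> 0"
      using CX.subspace_0[OF S(1)] by blast
    then obtain c where c: "w = (\<Sum>l<n. cscale (c l) (b l))"
      using S(2) span_lessThan_cases[of w b n] by (auto simp: W)
    then obtain j where j: "j < n" "c j \<noteq> 0"
      using w(2) by (metis (no_types, lifting) CX.scale_zero_left lessThan_iff sum.neutral)
    obtain g h d where d: "\<And>l. l < n \<Longrightarrow> rho (hv_var g) (rho (hv_var h) (b l)) = cscale (d l) (b l)"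
      "\<And>l. l < n \<Longrightarrow> l \<noteq> j \<Longrightarrow> d l \<noteq> d j"
      using isolated[OF j(1)] by blast
    have bj: "b j \<in> S"
      by (rule isolated_eigenvector_in_subspace
            [where f = "\<lambda>w. rho (hv_var g) (rho (hv_var h) w)" and c = c and d = d and n = n])
        (use S S_rho b d j w c in \<open>auto simp: rho_add_right rho_var_cscale rho_closed\<close>)
    have step: "b l \<in> S \<longleftrightarrow> b (Suc l) \<in> S" if l: "Suc l < n" for l
    proof -
      \<comment> \<open>In the second equation the summands are swapped, so that in both directions
        the vector already in \<open>S\<close> comes first.\<close>
      obtain g a c a' c' where nz: "c \<noteq> 0" "c' \<noteq> 0"
        and g: "rho (hv_var g) (b l) = cscale a (b l) + cscale c (b (Suc l))"
          "rho (hv_var g) (b (Suc l)) = cscale a' (b (Suc l)) + cscale c' (b l)"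
        using link[OF l] by (metis add.commute)
      show ?thesis
      proof
        assume "b l \<in> S"
        then show "b (Suc l) \<in> S"
          using comb_in_subspace_cancel[OF S(1)] nz S_rho g by metis
      next
        assume "b (Suc l) \<in> S"
        then show "b l \<in> S"
          using comb_in_subspace_cancel[OF S(1)] nz S_rho g by metis
      qed
    qed
    \<comment> \<open>Comparison with \<open>b 0\<close> carries membership from \<open>b j\<close>
      down to \<open>b 0\<close> and from there up to every index.\<close>
    have "l < n \<Longrightarrow> b l \<in> S \<longleftrightarrow> b 0 \<in> S" for l
      by (induction l) (use step in auto)
    then have "b ` {..<n} \<subseteq> S" using bj j(1) by blast
    then have "W \<subseteq> S" unfolding W using S(1) by (rule CX.span_minimal)
    then show ?thesis using S(2) by blast
  qed simp
qed


section \<open>The cell basis\<close>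

lemma cscale_comb_comb:
  "cscale a (cscale c v + cscale d w) + cscale a' (cscale c' v + cscale d' w)
    = cscale (a * c + a' * c') v + cscale (a * d + a' * d') w"
  by (simp add: cscale_def fun_eq_iff algebra_simps)

lemma block_t_action:
  assumes "acts_by_matrix b (block_t k q N D i) f" and "q \<noteq> 0" "D \<le> N"
  defines "p \<equiv> complex_of_nat q"
  shows "f (b 0) = cscale (k * (1 - p ^ (i + 1) + p ^ (N - D + 1))) (b 0)
      + cscale (k * (1 - p ^ (i + 1))) (b (Suc 0))"
    and "f (b (Suc 0)) = cscale (k * (p ^ (i + 1) - p ^ (N - D + 1))) (b 0)
      + cscale (k * p ^ (i + 1)) (b (Suc 0))"
proof -
  have p: "p \<noteq> 0" using assms(2) by (simp add: p_def)
  \<comment> \<open>The integer exponent may be negative; the prefactor clears it, because the two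
    exponents add up to \<open>i + 1\<close>.\<close>
  have "p ^ (N - D + 1) * p powi (int D - int N + int i)
      = p powi (int (N - D + 1) + (int D - int N + int i))"
    using p by (simp only: power_int_add power_int_of_nat disj_not1 simp_thms)
  also have "int (N - D + 1) + (int D - int N + int i) = int (i + 1)"
    using assms(3) by (simp add: of_nat_diff)
  finally have *: "p ^ (N - D + 1) * (p powi (int D - int N + int i) - 1)
      = p ^ (i + 1) - p ^ (N - D + 1)"
    by (simp only: power_int_of_nat right_diff_distrib mult_1_right)
  note 2 = acts_by_matrix_2x2[OF assms(1)[unfolded block_t_def Let_def p_def[symmetric] *]]
  show "f (b 0) = cscale (k * (1 - p ^ (i + 1) + p ^ (N - D + 1))) (b 0)
      + cscale (k * (1 - p ^ (i + 1))) (b (Suc 0))" by (rule 2(1))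
  show "f (b (Suc 0)) = cscale (k * (p ^ (i + 1) - p ^ (N - D + 1))) (b 0)
      + cscale (k * p ^ (i + 1)) (b (Suc 0))" by (rule 2(2))
qed

lemma block_u'_action:
  assumes "acts_by_matrix b (block_u' q i) f"
  defines "p \<equiv> complex_of_nat q"
  shows "f (b 0) = cscale (- 1) (b 0) + cscale (1 / p ^ (i + 1) - 1) (b (Suc 0))"
    and "f (b (Suc 0)) = 0"
proof -
  have "- int i - 1 = - int (i + 1)" by simp
  then have *: "p powi (- int i - 1) = 1 / p ^ (i + 1)"
    by (simp only: power_int_minus power_int_of_nat inverse_eq_divide)
  \<comment> \<open>The factor 1 gives the block the shape that \<open>acts_by_matrix_2x2\<close>
    expects.\<close>
  have "acts_by_matrix b (1 \<cdot>\<^sub>m mat_of_rows_list 2 [[- 1, 0], [1 / p ^ (i + 1) - 1, 0]]) f"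
    using assms(1) unfolding block_u'_def Let_def p_def[symmetric] * by (simp add: smult_mat_one)
  note 2 = acts_by_matrix_2x2[OF this]
  show "f (b 0) = cscale (- 1) (b 0) + cscale (1 / p ^ (i + 1) - 1) (b (Suc 0))"
    using 2(1) by simp
  show "f (b (Suc 0)) = 0" using 2(2) by simp
qed

lemma of_nat_power_eq_iff:
  assumes "q \<ge> 2"
  shows "(of_nat q :: 'a::semiring_char_0) ^ a = of_nat q ^ c \<longleftrightarrow> a = c"
  using assms by (simp add: of_nat_power[symmetric] del: of_nat_power)

text \<open>Here \<open>r\<close> is the field size as a natural number, used in the matrices, while
  \<open>q\<close> is the real parameter of the algebra. The two eigenvectors will show that
  \<open>k\<close> and \<open>k'\<close> occur as eigenvalues.\<close>

lemma (in hv_module) irreducible_and_eigenvectors_of_matrices: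
  fixes b :: "nat \<Rightarrow> 'x \<Rightarrow> complex" and r N D :: nat
  assumes r: "r \<ge> 2" and ND: "D \<ge> 1" "N \<ge> 2 * D" and nz: "k \<noteq> 0" "k' \<noteq> 0" "u \<noteq> 0"
    and W: "W = CX.span (b ` {..<2 * D})" and b0: "b 0 \<noteq> 0"
    and T: "acts_by_matrix b (mat_T k r N D) (rho (hv_var Gen_T))"
    and U': "acts_by_matrix b (mat_U' r D) (rho (hv_var Gen_U'))"
    and T': "acts_by_matrix b (mat_T' k' r D) (rho (hv_var Gen_T'))"
    and U: "acts_by_matrix b (mat_U u r D) (rho (hv_var Gen_U))"
  shows "hv_irreducible k k' u q W act"
    and "rho (hv_var Gen_T) (b 0 + b 1) = cscale k (b 0 + b 1)"
    and "rho (hv_var Gen_T') (b 0) = cscale k' (b 0)"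
proof -
  define p where "p = complex_of_nat r"
  have p: "p \<noteq> 0" using r by (simp add: p_def)
  have p_eq: "p ^ a = p ^ c \<longleftrightarrow> a = c" for a c
    unfolding p_def using r by (rule of_nat_power_eq_iff)
  have p_eq1: "p ^ a = 1 \<longleftrightarrow> a = 0" for a using p_eq[of a 0] by simp
  let ?T = "rho (hv_var Gen_T)" and ?U' = "rho (hv_var Gen_U')"
  let ?T' = "rho (hv_var Gen_T')" and ?U = "rho (hv_var Gen_U)"
  have b: "b l \<in> W" if "l < 2 * D" for l
    using that by (auto simp: W intro: CX.span_base)
  have var0: "rho (hv_var g) 0 = 0" for g
    using rho_var_cscale[OF CX.subspace_0[OF subspace], of g 0] by simp

  \<comment> \<open>Images of the basis vectors under the four generators\<close>
  have Tb: "?T (b (2 * i)) = cscale (k * (1 - p ^ (i + 1) + p ^ (N - D + 1))) (b (2 * i))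
        + cscale (k * (1 - p ^ (i + 1))) (b (Suc (2 * i)))"
      "?T (b (Suc (2 * i))) = cscale (k * (p ^ (i + 1) - p ^ (N - D + 1))) (b (2 * i))
        + cscale (k * p ^ (i + 1)) (b (Suc (2 * i)))" if "i < D" for i
    using block_t_action[OF mat_T_block[OF T that]] r ND by (simp_all add: p_def)
  have U'b: "?U' (b (2 * i)) = cscale (- 1) (b (2 * i)) + cscale (1 / p ^ (i + 1) - 1) (b (Suc (2 * i)))"
      "?U' (b (Suc (2 * i))) = 0" if "i < D" for i
    using block_u'_action[OF mat_U'_block[OF U' that]] by (simp_all add: p_def)
  \<comment> \<open>Block \<open>Suc i\<close> of \<open>T'\<close> starts at
    \<open>2 * Suc i - 1\<close>, so it joins the plus vector of cell \<open>i\<close> to the minus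
    vector of cell \<open>i + 1\<close>.\<close>
  have T'b: "?T' (b (Suc (2 * i))) = cscale (k' * (1 - p ^ (i + 1) + p ^ D)) (b (Suc (2 * i)))
        + cscale (k' * (1 - p ^ (i + 1))) (b (Suc (Suc (2 * i))))"
      "?T' (b (Suc (Suc (2 * i)))) = cscale (k' * (p ^ (i + 1) - p ^ D)) (b (Suc (2 * i)))
        + cscale (k' * p ^ (i + 1)) (b (Suc (Suc (2 * i))))"
      if "Suc i < D" for i
  proof -
    have "acts_by_matrix (\<lambda>j. b (Suc (2 * i) + j))
        (k' \<cdot>\<^sub>m mat_of_rows_list 2 [[1 - p ^ (i + 1) + p ^ D, p ^ (i + 1) - p ^ D],
          [1 - p ^ (i + 1), p ^ (i + 1)]]) ?T'"
      using mat_T'_block[OF T', of "Suc i"] that by (simp add: block_t'_def Let_def p_def)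
    from acts_by_matrix_2x2[OF this]
    show "?T' (b (Suc (2 * i))) = cscale (k' * (1 - p ^ (i + 1) + p ^ D)) (b (Suc (2 * i)))
        + cscale (k' * (1 - p ^ (i + 1))) (b (Suc (Suc (2 * i))))"
      "?T' (b (Suc (Suc (2 * i)))) = cscale (k' * (p ^ (i + 1) - p ^ D)) (b (Suc (2 * i)))
        + cscale (k' * p ^ (i + 1)) (b (Suc (Suc (2 * i))))" by simp_all
  qed
  have Ub: "?U (b (Suc (2 * i))) = cscale (- inverse u) (b (Suc (2 * i)))"
      "?U (b (Suc (Suc (2 * i)))) = cscale (inverse u * (1 - p ^ (D - Suc i))) (b (Suc (2 * i)))"
      if "Suc i < D" for i
  proof -
    have "acts_by_matrix (\<lambda>j. b (Suc (2 * i) + j))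
        (inverse u \<cdot>\<^sub>m mat_of_rows_list 2 [[- 1, 1 - p ^ (D - Suc i)], [0, 0]]) ?U"
      using mat_U_block[OF U, of "Suc i"] that by (simp add: block_u_def Let_def p_def)
    from acts_by_matrix_2x2[OF this]
    show "?U (b (Suc (2 * i))) = cscale (- inverse u) (b (Suc (2 * i)))"
      "?U (b (Suc (Suc (2 * i)))) = cscale (inverse u * (1 - p ^ (D - Suc i))) (b (Suc (2 * i)))"
      by simp_all
  qed
  \<comment> \<open>The first and the last basis vector form the blocks of size 1; the last index
    \<open>2 * D - 1\<close> is written in the form used for odd indices.\<close>
  have T'b_ends: "?T' (b 0) = cscale k' (b 0)"
      "?T' (b (Suc (2 * (D - 1)))) = cscale k' (b (Suc (2 * (D - 1))))"
  proof -
    have D: "2 * D - 1 = Suc (2 * (D - 1))" using ND by simp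
    show "?T' (b 0) = cscale k' (b 0)"
      using mat_T'_block[OF T', of 0] ND acts_by_matrix_1x1[of b k']
      by (simp add: block_t'_def Let_def)
    show "?T' (b (Suc (2 * (D - 1)))) = cscale k' (b (Suc (2 * (D - 1))))"
      using mat_T'_block[OF T', of D] ND
        acts_by_matrix_1x1[of "\<lambda>j. b (Suc (2 * (D - 1)) + j)" k' ?T']
      unfolding D by (simp add: block_t'_def Let_def)
  qed
  have Ub_ends: "?U (b 0) = 0"
      "?U (b (Suc (2 * (D - 1)))) = cscale (- inverse u) (b (Suc (2 * (D - 1))))"
  proof -
    have D: "2 * D - 1 = Suc (2 * (D - 1))" using ND by simp
    have "acts_by_matrix b (mat_of_rows_list 1 [[0]]) ?U"
      using mat_U_block[OF U, of 0] ND by (simp add: block_u_def Let_def)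
    from acts_by_matrix_1x1[OF this] show "?U (b 0) = 0" by (simp only: CX.scale_zero_left)
    show "?U (b (Suc (2 * (D - 1)))) = cscale (- inverse u) (b (Suc (2 * (D - 1))))"
      using mat_U_block[OF U, of D] ND
        acts_by_matrix_1x1[of "\<lambda>j. b (Suc (2 * (D - 1)) + j)" "- inverse u" ?U]
      unfolding D by (simp add: block_u_def Let_def)
  qed

  \<comment> \<open>The products \<open>T U'\<close> and \<open>U T'\<close> are diagonal\<close>
  have TU': "?T (?U' (b (2 * i))) = cscale (- k * p ^ (N - D - i)) (b (2 * i))"
    and TU'_odd: "?T (?U' (b (Suc (2 * i)))) = 0" if i: "i < D" for i
  proof -
    \<comment> \<open>With \<open>x = p ^ (i + 1)\<close> and \<open>y = p ^ (N - D + 1)\<close>,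
      the diagonal coefficient collapses to \<open>- k * y / x\<close> and the off-diagonal one to
      0. The splitting of exponents uses \<open>i < D\<close> and
      \<open>D \<le> N - D\<close>.\<close>
    have "p ^ (N - D + 1) = p ^ (N - D - i) * p ^ (i + 1)"
      using i ND by (simp flip: power_add)
    then have e: "- 1 * (k * (1 - p ^ (i + 1) + p ^ (N - D + 1)))
        + (1 / p ^ (i + 1) - 1) * (k * (p ^ (i + 1) - p ^ (N - D + 1))) = - k * p ^ (N - D - i)"
      "- 1 * (k * (1 - p ^ (i + 1))) + (1 / p ^ (i + 1) - 1) * (k * p ^ (i + 1)) = 0"
      using p by (simp_all add: divide_simps) (simp_all add: algebra_simps)
    have "?T (?U' (b (2 * i))) = cscale (- 1) (?T (b (2 * i)))
        + cscale (1 / p ^ (i + 1) - 1) (?T (b (Suc (2 * i))))"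
      unfolding U'b(1)[OF i] using i by (intro rho_var_comb b) auto
    then show "?T (?U' (b (2 * i))) = cscale (- k * p ^ (N - D - i)) (b (2 * i))"
      unfolding Tb[OF i] cscale_comb_comb e by simp
    show "?T (?U' (b (Suc (2 * i)))) = 0" using U'b(2)[OF i] var0 by simp
  qed
  \<comment> \<open>\<open>U\<close> sends both vectors of a block of size 2 to multiples of the odd
    one, so a single coefficient remains. The last vector is a block of its own, where the power of
    \<open>p\<close> is 1.\<close>
  have UT': "?U (?T' (b (Suc (2 * i)))) = cscale (- (inverse u * k') * p ^ (D - Suc i)) (b (Suc (2 * i)))"
    if i: "i < D" for i
  proof (cases "Suc i < D")
    case True
    have "D = D - Suc i + (i + 1)" using i by simp
    then have "p ^ D = p ^ (D - Suc i) * p ^ (i + 1)" by (metis power_add)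
    then have e: "k' * (1 - p ^ (i + 1) + p ^ D) * (- inverse u)
        + k' * (1 - p ^ (i + 1)) * (inverse u * (1 - p ^ (D - Suc i)))
        = - (inverse u * k') * p ^ (D - Suc i)"
      by (simp add: algebra_simps)
    have "?U (?T' (b (Suc (2 * i)))) = cscale (k' * (1 - p ^ (i + 1) + p ^ D)) (?U (b (Suc (2 * i))))
        + cscale (k' * (1 - p ^ (i + 1))) (?U (b (Suc (Suc (2 * i)))))"
      unfolding T'b(1)[OF True] using True by (intro rho_var_comb b) auto
    then show ?thesis
      unfolding Ub[OF True] CX.scale_scale CX.scale_left_distrib[symmetric] e .
  next
    case False
    then have i: "i = D - 1" using i by simp
    have "b (Suc (2 * (D - 1))) \<in> W" using ND by (intro b) auto
    moreover have "D - Suc (D - 1) = 0" using ND by simp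
    ultimately show ?thesis
      unfolding i T'b_ends(2) by (simp only: rho_var_cscale Ub_ends) (simp add: mult.commute)
  qed
  \<comment> \<open>For positive \<open>i\<close> the vector \<open>b (2 * i)\<close> is the second
    one of its block, and the two contributions to the odd vector cancel. The vector
    \<open>b 0\<close> is killed by \<open>U\<close> directly.\<close>
  have UT'_even: "?U (?T' (b (2 * i))) = 0" if i: "i < D" for i
  proof (cases i)
    case 0
    have "b 0 \<in> W" using ND by (intro b) auto
    then show ?thesis using 0 T'b_ends(1) Ub_ends(1) by (simp add: rho_var_cscale)
  next
    case (Suc m)
    then have m: "Suc m < D" using i by simp
    have "D = D - Suc m + (m + 1)" using m by simp
    then have "p ^ D = p ^ (D - Suc m) * p ^ (m + 1)" by (metis power_add)
    then have e: "k' * (p ^ (m + 1) - p ^ D) * (- inverse u)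
        + k' * p ^ (m + 1) * (inverse u * (1 - p ^ (D - Suc m))) = 0"
      by (simp add: algebra_simps)
    have "?U (?T' (b (Suc (Suc (2 * m))))) = cscale (k' * (p ^ (m + 1) - p ^ D)) (?U (b (Suc (2 * m))))
        + cscale (k' * p ^ (m + 1)) (?U (b (Suc (Suc (2 * m)))))"
      unfolding T'b(2)[OF m] using m by (intro rho_var_comb b) auto
    then have "?U (?T' (b (Suc (Suc (2 * m))))) = 0"
      unfolding Ub[OF m] CX.scale_scale CX.scale_left_distrib[symmetric] e by simp
    then show ?thesis using Suc by simp
  qed

  \<comment> \<open>Irreducibility: nonzero links and distinct eigenvalues\<close>
  show "hv_irreducible k k' u q W act"
  proof (rule irreducible_of_linked_basis[OF W _ b0])
    show "0 < 2 * D" using ND by simp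
  next
    fix j assume j: "Suc j < 2 * D"
    show "\<exists>g a c a' c'. c \<noteq> 0 \<and> c' \<noteq> 0
      \<and> rho (hv_var g) (b j) = cscale a (b j) + cscale c (b (Suc j))
      \<and> rho (hv_var g) (b (Suc j)) = cscale c' (b j) + cscale a' (b (Suc j))"
    proof (cases "even j")
      case True
      then obtain i where i: "j = 2 * i" "i < D" using j by (auto elim!: evenE)
      \<comment> \<open>Distinct exponents give distinct powers, and
        \<open>0 < i + 1 < N - D + 1\<close> because \<open>i < D\<close> and
        \<open>D \<le> N - D\<close>.\<close>
      have "k * (1 - p ^ (i + 1)) \<noteq> 0" "k * (p ^ (i + 1) - p ^ (N - D + 1)) \<noteq> 0"
        using p_eq1[of "i + 1"] p_eq[of "i + 1" "N - D + 1"] nz i ND by auto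
      then show ?thesis using Tb[OF i(2)] i(1) by blast
    next
      case False
      then obtain i where i: "j = Suc (2 * i)" "Suc i < D" using j by (auto elim!: oddE)
      have "k' * (1 - p ^ (i + 1)) \<noteq> 0" "k' * (p ^ (i + 1) - p ^ D) \<noteq> 0"
        using p_eq1[of "i + 1"] p_eq[of "i + 1" D] nz i by auto
      then show ?thesis using T'b[OF i(2)] i(1) by blast
    qed
  next
    fix j assume j: "j < 2 * D"
    show "\<exists>g h d. (\<forall>l<2 * D. rho (hv_var g) (rho (hv_var h) (b l)) = cscale (d l) (b l))
      \<and> (\<forall>l<2 * D. l \<noteq> j \<longrightarrow> d l \<noteq> d j)"
    proof (cases "even j")
      case True
      let ?d = "\<lambda>l. if even l then - k * p ^ (N - D - l div 2) else 0"
      have diag: "?T (?U' (b l)) = cscale (?d l) (b l)" if l: "l < 2 * D" for l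
      proof (cases "even l")
        case True
        then obtain i where "l = 2 * i" "i < D" using l by (auto elim!: evenE)
        then show ?thesis using TU' by simp
      next
        case False
        then obtain i where "l = Suc (2 * i)" "i < D" using l by (auto elim!: oddE)
        then show ?thesis using TU'_odd by simp
      qed
      have isolated: "?d l \<noteq> ?d j" if "l < 2 * D" "l \<noteq> j" for l
      proof (cases "even l")
        case even_l: True
        with True that have "l div 2 \<noteq> j div 2" by (metis dvd_mult_div_cancel)
        \<comment> \<open>These bounds keep the truncated subtractions in the exponents
          injective.\<close>
        moreover have "l div 2 < N - D" "j div 2 < N - D" using that j ND by auto
        ultimately have "N - D - l div 2 \<noteq> N - D - j div 2" by linarith
        then show ?thesis using True even_l nz p_eq by simp
      qed (use True nz p in simp)
      show ?thesis
        by (intro exI[of _ Gen_T] exI[of _ Gen_U'] exI[of _ ?d] conjI allI impI diag isolated)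
    next
      case False
      \<comment> \<open>Odd indices lie in the kernel of \<open>T U'\<close>, so they are separated
        by \<open>U T'\<close>, which vanishes on the even ones.\<close>
      let ?d = "\<lambda>l. if odd l then - (inverse u * k') * p ^ (D - Suc (l div 2)) else 0"
      have diag: "?U (?T' (b l)) = cscale (?d l) (b l)" if l: "l < 2 * D" for l
      proof (cases "even l")
        case True
        then obtain i where "l = 2 * i" "i < D" using l by (auto elim!: evenE)
        then show ?thesis using UT'_even by simp
      next
        case False
        then obtain i where "l = Suc (2 * i)" "i < D" using l by (auto elim!: oddE)
        then show ?thesis using UT' by simp
      qed
      have isolated: "?d l \<noteq> ?d j" if "l < 2 * D" "l \<noteq> j" for l
      proof (cases "odd l")
        case odd_l: True
        with False that have "l div 2 \<noteq> j div 2" by (metis odd_two_times_div_two_succ)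
        moreover have "l div 2 < D" "j div 2 < D" using that j by auto
        ultimately have "D - Suc (l div 2) \<noteq> D - Suc (j div 2)" by linarith
        then show ?thesis using False odd_l nz p_eq by simp
      qed (use False nz p in simp)
      show ?thesis
        by (intro exI[of _ Gen_U] exI[of _ Gen_T'] exI[of _ ?d] conjI allI impI diag isolated)
    qed
  qed

  \<comment> \<open>Eigenvectors of \<open>T\<close> and \<open>T'\<close>\<close>
  have "b 0 \<in> W" "b 1 \<in> W" using ND by (auto intro!: b)
  then have "?T (b 0 + b 1) = ?T (b 0) + ?T (b 1)" by (rule rho_add_right)
  \<comment> \<open>Both rows of the first block of \<open>T\<close> sum to
    \<open>k\<close>.\<close>
  also have "\<dots> = cscale k (b 0 + b 1)"
  proof -
    have Tb0: "?T (b 0) = cscale (k * (1 - p + p ^ (N - D + 1))) (b 0) + cscale (k * (1 - p)) (b 1)"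
      "?T (b 1) = cscale (k * (p - p ^ (N - D + 1))) (b 0) + cscale (k * p) (b 1)"
      using Tb[of 0] ND by simp_all
    show ?thesis
      unfolding Tb0 by (simp add: cscale_def fun_eq_iff algebra_simps)
  qed
  finally show "?T (b 0 + b 1) = cscale k (b 0 + b 1)" .
  show "?T' (b 0) = cscale k' (b 0)" by (rule T'b_ends(1))
qed

section \<open>The cell space, its first vector and the parameters\<close>

lemma cell_space_eq_span:
  fixes scl :: "'f::field \<Rightarrow> 'v::ab_group_add \<Rightarrow> 'v"
  shows "cell_space scl D C x = CX.span (cell_vec scl D C x ` {..<2 * D})"
proof -
  let ?m = "\<lambda>i. indicator (clique_cell_minus scl D C x i) :: 'v set \<Rightarrow> complex"
  let ?p = "\<lambda>i. indicator (clique_cell_plus scl D C x i) :: 'v set \<Rightarrow> complex"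
  have cell: "cell_vec scl D C x (2 * i) = ?m i" "cell_vec scl D C x (Suc (2 * i)) = ?p i" for i
    by (simp_all add: cell_vec_def)
  have "(\<Union>i<D. {?m i, ?p i}) = cell_vec scl D C x ` {..<2 * D}"
  proof (intro equalityI subsetI)
    fix f assume "f \<in> (\<Union>i<D. {?m i, ?p i})"
    then obtain i where "i < D" "f = cell_vec scl D C x (2 * i) \<or> f = cell_vec scl D C x (Suc (2 * i))"
      by (auto simp: cell)
    then show "f \<in> cell_vec scl D C x ` {..<2 * D}" by auto
  next
    fix f assume "f \<in> cell_vec scl D C x ` {..<2 * D}"
    then obtain j where "j < 2 * D" "f = cell_vec scl D C x j" by auto
    then show "f \<in> (\<Union>i<D. {?m i, ?p i})"
      by (auto simp: cell_vec_def intro!: bexI[of _ "j div 2"])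
  qed
  then show ?thesis by (simp add: cell_space_def)
qed

lemma path_dist_self: "path_dist E y y = 0"
  unfolding path_dist_def by (rule Least_eq_0) simp

text \<open>Makes the first basis vector take the value 1 at \<open>x\<close>, hence
  nonzero.\<close>

lemma mem_clique_cell_minus_0:
  assumes "delsarte_clique scl q N D C" "q \<ge> 2" "x \<in> C"
  shows "x \<in> clique_cell_minus scl D C x 0"
proof -
  \<comment> \<open>Infinite sets have \<open>card\<close> 0, so the positive clique size yields the
    finiteness of \<open>C\<close> on which \<open>Min\<close> relies.\<close>
  have "(1 :: real) < real q ^ (N - D + 1)" using assms(2) by (intro one_less_power) auto
  then have "0 < real (card C)"
    using assms(1,2) by (auto simp: delsarte_clique_def)
  then have "finite C" using card_ge_0_finite by simp
  then have "Min ((\<lambda>z. path_dist (grassmann_adj scl D) x z) ` C) = 0"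
    using assms(3) by (intro Min_eqI) (auto simp: image_iff path_dist_self intro!: bexI[of _ x])
  then show ?thesis
    using assms(1,3)
    by (auto simp: clique_cell_minus_def clique_cell_def delsarte_clique_def path_dist_self)
qed

text \<open>A zero sum would force \<open>c\<close> and its inverse to have equal modulus, but one
  modulus is below 1 and the other above.\<close>

lemma add_inverse_nonzero:
  fixes c :: complex
  assumes "cmod c < 1" "c \<noteq> 0"
  shows "c + inverse c \<noteq> 0"
proof
  assume "c + inverse c = 0"
  then have "inverse c = - c" by (simp add: add_eq_0_iff)
  then have "cmod c = inverse (cmod c)" by (metis norm_inverse norm_minus_cancel)
  moreover have "inverse (cmod c) > 1" using assms by (simp add: one_less_inverse)
  ultimately show False using assms by simp
qed

lemma cmod_i_powr:
  "cmod (\<i> * complex_of_real (real q powr s)) = real q powr s"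
  by (simp add: norm_mult)

theorem mainTheorem4:
  fixes scl :: "'f::{field,finite} \<Rightarrow> 'v::ab_group_add \<Rightarrow> 'v"
    and q N D :: nat
    and C :: "'v set set" and x :: "'v set"
    and W :: "('v set \<Rightarrow> complex) set"
    and k k' u :: complex
    and act :: "hv_free set \<Rightarrow> ('v set \<Rightarrow> complex) \<Rightarrow> ('v set \<Rightarrow> complex)"
  assumes "primepow q" and "card (UNIV :: 'f set) = q"
    and "vector_space scl" and "vector_space.dim scl UNIV = N"
    and "D \<ge> 3" and "N \<ge> 2 * D"
    and "delsarte_clique scl q N D C" and "x \<in> C"
    and "W = cell_space scl D C x"
    and "k = \<i> * complex_of_real (real q powr ((real D - real N - 1) / 2))"
    and "k' = \<i> * complex_of_real (real q powr (- real D / 2))"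
    and "u = complex_of_real (real q powr (real D - real N / 2))"
    and "hv_module k k' u (real q) W act"
    and "acts_by_matrix (cell_vec scl D C x) (mat_T k q N D)
           (act (hv_class k k' u (real q) (hv_var Gen_T)))"
    and "acts_by_matrix (cell_vec scl D C x) (mat_U' q D)
           (act (hv_class k k' u (real q) (hv_var Gen_U')))"
    and "acts_by_matrix (cell_vec scl D C x) (mat_T' k' q D)
           (act (hv_class k k' u (real q) (hv_var Gen_T')))"
    and "acts_by_matrix (cell_vec scl D C x) (mat_U u q D)
           (act (hv_class k k' u (real q) (hv_var Gen_U)))"
  shows "hv_irreducible k k' u (real q) W act
    \<and> diagonalizable_on W (act (hv_class k k' u (real q) (hv_var Gen_T)))
    \<and> diagonalizable_on W (act (hv_class k k' u (real q) (hv_var Gen_T')))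
    \<and> eigenprojection W (act (hv_class k k' u (real q) (hv_var Gen_T))) k
        (act (hv_class k k' u (real q)
           (hv_const (1 / (k + inverse k)) * (hv_var Gen_T + hv_const (inverse k)))))
    \<and> eigenprojection W (act (hv_class k k' u (real q) (hv_var Gen_T'))) k'
        (act (hv_class k k' u (real q)
           (hv_const (1 / (k' + inverse k')) * (hv_var Gen_T' + hv_const (inverse k')))))"
proof -
  have q: "q \<ge> 2" using primepow_gt_Suc_0[OF assms(1)] by simp
  have ND: "D \<ge> 1" "N \<ge> 2 * D" using assms by auto
  interpret hv_module k k' u "real q" W act by (rule assms)
  let ?b = "cell_vec scl D C x"
  have W: "W = CX.span (?b ` {..<2 * D})"
    using assms(9) by (simp add: cell_space_eq_span)
  have b0x: "?b 0 x = 1"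
    using mem_clique_cell_minus_0[OF assms(7) q assms(8)] by (simp add: cell_vec_def)
  then have b0: "?b 0 \<noteq> 0" by (metis zero_fun_apply zero_neq_one)
  \<comment> \<open>At \<open>x\<close> the first vector is 1 and the second is 0 or 1, so the sum
    cannot vanish there.\<close>
  have b01: "?b 0 + ?b 1 \<noteq> 0"
  proof
    assume "?b 0 + ?b 1 = 0"
    then have "?b 0 x + ?b 1 x = 0" by (metis plus_fun_apply zero_fun_apply)
    moreover have "?b 1 x = 0 \<or> ?b 1 x = 1" by (simp add: cell_vec_def indicator_def)
    ultimately show False using b0x by auto
  qed
  have nz: "k \<noteq> 0" "k' \<noteq> 0" "u \<noteq> 0"
    using q assms(10-12) by simp_all
  \<comment> \<open>Both moduli are powers of \<open>q > 1\<close> with negative exponents.\<close>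
  have "cmod k < 1" "cmod k' < 1"
    unfolding assms(10,11) cmod_i_powr using q ND by (auto intro!: powr_less_one)
  then have k: "k + inverse k \<noteq> 0" "k' + inverse k' \<noteq> 0"
    using nz add_inverse_nonzero by auto
  note action = irreducible_and_eigenvectors_of_matrices[OF q ND nz W b0 assms(14-17)]
  have "?b 0 \<in> W" "?b 1 \<in> W"
    unfolding W using ND by (auto intro!: CX.span_base)
  then have bW: "?b 0 \<in> W" "?b 0 + ?b 1 \<in> W"
    unfolding W by (auto intro: CX.span_add)
  have rel: "(hv_var Gen_T - hv_const k) * (hv_var Gen_T + hv_const (inverse k))
      \<in> hv_relators k k' u (real q)"
    "(hv_var Gen_T' - hv_const k') * (hv_var Gen_T' + hv_const (inverse k'))
      \<in> hv_relators k k' u (real q)"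
    by (simp_all add: hv_relators_def Let_def)
  show ?thesis
    using action(1) eigenprojection_of_relator[OF rel(1) k(1) bW(2) b01 action(2)]
      eigenprojection_of_relator[OF rel(2) k(2) bW(1) b0 action(3)]
    by blast
qed

end
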